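(* Let $q$ be a complex number with $0<|q|<1$. (1) Let $(\lambda_m)_{m\ge 0}$, $(\mu_m)_{m\ge 0}$, $(\nu_m)_{m\ge 0}$ be the sequences each satisfying, for $m\ge 3$, the recursion $$x_m=(1+q^{m-3})x_{m-1}+q^{-1}x_{m-2}-q^{-1}x_{m-3}\qquad (x=\lambda,\mu,\nu),$$ with initial values $$\lambda_0=q,\ \lambda_1=0,\ \lambda_2=1;\qquad \mu_0=0,\ \mu_1=1,\ \mu_2=0;\qquad \nu_0=1,\ \nu_1=0,\ \nu_2=0.$$ Then for every integer $m\ge 0$, $$\sum_{n=0}^{\infty}\frac{q^{n^2+mn}}{(q;q^2)_{n+1}(q;q)_n}=\frac{(q^2,q^{12},q^{14};q^{14})_{\infty}}{(q;q)_{\infty}}\lambda_m+\frac{(q^4,q^{10},q^{14};q^{14})_{\infty}}{(q;q)_{\infty}}\mu_m+\frac{(q^6,q^8,q^{14};q^{14})_{\infty}}{(q;q)_{\infty}}\nu_m.$$ (2) Let $(E_m)_{m\ge 0}$, $(F_m)_{m\ge 0}$, $(G_m)_{m\ge 0}$ be the sequences each satisfying, for $m\ge 3$, the recursion $$X_m=(1+q^{m-1})X_{m-1}+qX_{m-2}-qX_{m-3}\qquad (X=E,F,G),$$ with initial values $$E_0=0,\ E_1=-q,\ E_2=-q-q^2;\qquad F_0=0,\ F_1=0,\ F_2=-q;\qquad G_0=1,\ G_1=1,\ G_2=1+q.$$ Then for every integer $m\ge 0$, $$\sum_{n=0}^{\infty}\frac{q^{n^2+mn}}{(q;q^2)_n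(q;q)_n}=\frac{(q^2,q^{12},q^{14};q^{14})_{\infty}}{(q;q)_{\infty}}E_m+\frac{(q^4,q^{10},q^{14};q^{14})_{\infty}}{(q;q)_{\infty}}F_m+\frac{(q^6,q^8,q^{14};q^{14})_{\infty}}{(q;q)_{\infty}}G_m.$$
   Context: For $|p|<1$, $(a;p)_\infty=\prod_{k=0}^{\infty}(1-ap^k)$ and, for an integer $n\ge 0$, $(a;p)_n=\prod_{k=0}^{n-1}(1-ap^k)$. Multiple $q$-shifted factorials are products: $(a_1,\dots,a_r;p)_\infty=(a_1;p)_\infty\cdots(a_r;p)_\infty$. *)

theory Defs
  imports "HOL-Analysis.Infinite_Products"
begin

definition qpoch :: "complex \<Rightarrow> complex \<Rightarrow> nat \<Rightarrow> complex" where
  "qpoch a p n = (\<Prod>k<n. 1 - a * p ^ k)"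

(* Meaningful for norm p < 1, where the product converges. *)
definition qpoch_inf :: "complex \<Rightarrow> complex \<Rightarrow> complex" where
  "qpoch_inf a p = (\<Prod>k. 1 - a * p ^ k)"

definition qpochs_inf :: "complex list \<Rightarrow> complex \<Rightarrow> complex" where
  "qpochs_inf as p = (\<Prod>a\<leftarrow>as. qpoch_inf a p)"

end

theory Submission
  imports Defs
begin

text \<open>
  Let \<open>U(a,K) = \<Sum>n. q^(n\<^sup>2+an) / ((q;q\<^sup>2)\<^bsub>n+K\<^esub> (q;q)\<^bsub>n\<^esub>)\<close>, so that the two families of series are
  \<open>U(m,1)\<close> and \<open>U(m,0)\<close>. Elementary manipulations give
  \<open>U(a,K) - U(a+1,K) = q^(a+1) U(a+2,K+1)\<close> and \<open>U(a,K) = U(a,K+1) - q^(2K+1) U(a+2,K+1)\<close>,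
  from which both recursions in \<open>m\<close> follow, as well as \<open>U(m,0) = U(m,1) - q U(m+2,1)\<close>.
  It remains to prove Rogers' three identities modulo 14, for \<open>U(2,1)\<close>, \<open>U(1,1)\<close> and \<open>U(0,0)\<close>.
  With \<open>p = q\<^sup>2\<close>, the sequences \<open>X\<^sub>1(N) = U(2N+2,N+1)\<close>, \<open>X\<^sub>2(N) = U(2N+1,N+1)\<close>, \<open>X\<^sub>3(N) = U(2N,N)\<close>
  satisfy the system
  \<open>X\<^sub>1(N) = X\<^sub>3(N+1)\<close>, \<open>X\<^sub>2(N) - X\<^sub>1(N) = p^(N+1) X\<^sub>2(N+1)\<close>, \<open>X\<^sub>3(N) - X\<^sub>2(N) = p^(2N+2) X\<^sub>1(N+1)\<close>
  of Gordon's identities modulo 7 in base \<open>p\<close>, which a null sequence can only satisfy trivially.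
  The classical theta-type series satisfy the same system, have proportional limits, and are evaluated
  at \<open>N = 0\<close> by the Jacobi triple product.
\<close>

section \<open>Shifted factorials and the Jacobi triple product\<close>

lemma qpoch_0 [simp]: "qpoch a p 0 = 1"
  by (simp add: qpoch_def)

lemma qpoch_Suc: "qpoch a p (Suc n) = qpoch a p n * (1 - a * p ^ n)"
  by (simp add: qpoch_def)

lemma qpoch_Suc_shift: "qpoch a p (Suc n) = (1 - a) * qpoch (a * p) p n"
  unfolding qpoch_def by (subst prod.lessThan_Suc_shift) (simp add: mult_ac)

lemma qpoch_add: "qpoch a p (m + n) = qpoch a p m * qpoch (a * p ^ m) p n"
  by (induction n) (simp_all add: qpoch_Suc power_add mult_ac)

lemma qpoch_mult_double: "qpoch q q (2 * n) = qpoch q (q\<^sup>2) n * qpoch (q\<^sup>2) (q\<^sup>2) n"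
  by (induction n) (simp_all add: qpoch_Suc flip: power_mult power_Suc power_add)

context
  fixes p :: complex
  assumes p: "norm p < 1"
begin

lemma qpoch_convergent_prod: "convergent_prod (\<lambda>k. 1 - a * p ^ k)"
proof (rule abs_convergent_prod_imp_convergent_prod, rule summable_imp_abs_convergent_prod)
  show "summable (\<lambda>k. norm (1 - a * p ^ k - 1))"
    using p by (simp add: norm_mult norm_power summable_mult)
qed

lemma qpoch_tendsto: "qpoch a p \<longlonglongrightarrow> qpoch_inf a p"
proof -
  have "(\<lambda>n. qpoch a p (Suc n)) \<longlonglongrightarrow> qpoch_inf a p"
    using convergent_prod_LIMSEQ[OF qpoch_convergent_prod[of a]]
    by (simp add: qpoch_def qpoch_inf_def lessThan_Suc_atMost)
  thus ?thesis by (simp add: filterlim_sequentially_Suc)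
qed

lemma qpoch_nonzero_of_small:
  assumes "norm a < 1"
  shows "qpoch a p n \<noteq> 0" "qpoch_inf a p \<noteq> 0"
proof -
  have nz: "1 - a * p ^ k \<noteq> 0" for k
  proof
    assume "1 - a * p ^ k = 0"
    hence "norm (a * p ^ k) = 1" by simp
    moreover have "norm (a * p ^ k) \<le> norm a * 1"
      unfolding norm_mult norm_power using p by (intro mult_left_mono power_le_one) auto
    ultimately show False using assms by simp
  qed
  show "qpoch a p n \<noteq> 0" using nz by (simp add: qpoch_def)
  show "qpoch_inf a p \<noteq> 0"
    unfolding qpoch_inf_def by (rule prodinf_nonzero[OF qpoch_convergent_prod nz])
qed

lemma qpoch_bounded: "\<exists>B>0. \<forall>n. norm (qpoch a p n) \<le> B"
  using convergent_imp_Bseq[OF convergentI[OF qpoch_tendsto[of a]]] by (auto elim: BseqE)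

lemma qpoch_inverse_bounded:
  assumes "norm a < 1"
  shows "\<exists>B>0. \<forall>n. norm (inverse (qpoch a p n)) \<le> B"
proof -
  have "(\<lambda>n. inverse (qpoch a p n)) \<longlonglongrightarrow> inverse (qpoch_inf a p)"
    using qpoch_nonzero_of_small[OF assms] by (intro tendsto_inverse qpoch_tendsto)
  from convergent_imp_Bseq[OF convergentI[OF this]] show ?thesis
    by (auto elim: BseqE)
qed

end

section \<open>Dominated limits of series, Gaussian binomials and Rothe's theorem\<close>

lemma tendsto_suminf_dominated:
  fixes a :: "nat \<Rightarrow> nat \<Rightarrow> complex"
  assumes "\<And>k. (\<lambda>n. a k n) \<longlonglongrightarrow> b k" "\<And>k n. norm (a k n) \<le> M k" "summable M"
  shows "(\<lambda>n. \<Sum>k. a k n) \<longlonglongrightarrow> (\<Sum>k. b k)" "summable b"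
proof -
  have *: "summable (\<lambda>n. norm (b n)) \<and> (\<lambda>n. \<Sum>k. a k n) \<longlonglongrightarrow> (\<Sum>k. b k)"
    using tannerys_theorem[of a b sequentially M] assms by (auto intro: always_eventually)
  show "(\<lambda>n. \<Sum>k. a k n) \<longlonglongrightarrow> (\<Sum>k. b k)" "summable b"
    using * summable_norm_cancel by auto
qed

text \<open>The Gaussian binomial coefficient. Taking the q-Pascal rule as definition avoids
  quotients, so that it makes sense at roots of unity as well.\<close>

fun qbinomial :: "complex \<Rightarrow> nat \<Rightarrow> nat \<Rightarrow> complex" where
  "qbinomial p n 0 = 1"
| "qbinomial p 0 (Suc k) = 0"
| "qbinomial p (Suc n) (Suc k) = qbinomial p n k + p ^ Suc k * qbinomial p n (Suc k)"

lemma qbinomial_eq_0: "n < k \<Longrightarrow> qbinomial p n k = 0"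
  by (induction p n k rule: qbinomial.induct) auto

lemma qbinomial_qpoch:
  "qbinomial p (k + d) k * (qpoch p p k * qpoch p p d) = qpoch p p (k + d)"
proof (induction "k + d" arbitrary: k d)
  case (Suc n)
  show ?case
  proof (cases k)
    case k: (Suc k')
    show ?thesis
    proof (cases d)
      case 0
      with Suc(1)[of k' 0] Suc(2) k show ?thesis by (auto simp: qbinomial_eq_0 qpoch_Suc)
    next
      case d: (Suc d')
      have 1: "qbinomial p (k' + Suc d') k' * (qpoch p p k' * qpoch p p (Suc d')) = qpoch p p (k' + Suc d')"
        and 2: "qbinomial p (Suc k' + d') (Suc k') * (qpoch p p (Suc k') * qpoch p p d') = qpoch p p (Suc k' + d')"
        using Suc(1)[of k' "Suc d'"] Suc(1)[of "Suc k'" d'] Suc(2) k d by auto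
      \<comment> \<open>The two Pascal summands carry the factors \<open>1 - p ^ Suc k'\<close> and
        \<open>p ^ Suc k' * (1 - p ^ Suc d')\<close>, whose sum is the last factor
        \<open>1 - p ^ (k + d)\<close> of \<open>qpoch p p (k + d)\<close>.\<close>
      have "qbinomial p (k + d) k * (qpoch p p k * qpoch p p d)
          = qbinomial p (k' + Suc d') k' * (qpoch p p k' * qpoch p p (Suc d')) * (1 - p ^ Suc k')
          + p ^ Suc k' * (1 - p ^ Suc d')
             * (qbinomial p (Suc k' + d') (Suc k') * (qpoch p p (Suc k') * qpoch p p d'))"
        by (simp add: k d qpoch_Suc ring_distribs mult_ac)
      also have "\<dots> = qpoch p p (k + d)"
        unfolding 1 2 by (simp add: k d qpoch_Suc power_add algebra_simps)
      finally show ?thesis .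
    qed
  qed auto
qed auto

lemma qbinomial_eq:
  assumes "norm p < 1"
  shows "qbinomial p (k + d) k = qpoch p p (k + d) * (inverse (qpoch p p k) * inverse (qpoch p p d))"
  using qbinomial_qpoch[of p k d] qpoch_nonzero_of_small(1)[OF assms assms]
  by (simp add: field_simps)

lemma Suc_choose_two: "Suc n choose 2 = (n choose 2) + n"
  by (simp add: numeral_2_eq_2)

lemma add_choose_two: "(m + n) choose 2 = (m choose 2) + (n choose 2) + m * n"
  by (induction n) (simp_all add: Suc_choose_two)

text \<open>Splitting off the first factor \<open>1 - y\<close> rather than the last replaces
  \<open>y\<close> by \<open>y * p\<close> in the induction hypothesis; this supplies the power of
  \<open>p\<close> in the q-Pascal rule.\<close>

lemma rothe_qbinomial_theorem: "qpoch y p n = (\<Sum>j\<le>n. (-1) ^ j * p ^ (j choose 2) * qbinomial p n j * y ^ j)"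
proof (induction n arbitrary: y)
  case (Suc n)
  define c where "c j = (-1) ^ j * p ^ (j choose 2)" for j :: nat
  have c: "c (Suc j) = - c j * p ^ j" for j
    by (simp add: c_def Suc_choose_two power_add)
  have "qpoch y p (Suc n) = (1 - y) * (\<Sum>j\<le>n. c j * qbinomial p n j * (y * p) ^ j)"
    by (simp add: qpoch_Suc_shift Suc.IH c_def)
  also have "\<dots> = (\<Sum>j\<le>n. c j * qbinomial p n j * (y * p) ^ j)
                  + (\<Sum>j\<le>n. c (Suc j) * qbinomial p n j * y ^ Suc j)"
    unfolding sum_distrib_left sum.distrib[symmetric]
    by (intro sum.cong) (simp_all add: c power_mult_distrib algebra_simps)
  also have "(\<Sum>j\<le>n. c j * qbinomial p n j * (y * p) ^ j) = (\<Sum>j\<le>Suc n. c j * qbinomial p n j * (y * p) ^ j)"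
    by (simp add: qbinomial_eq_0)
  also have "\<dots> = 1 + (\<Sum>j\<le>n. c (Suc j) * qbinomial p n (Suc j) * (y * p) ^ Suc j)"
    by (subst sum.atMost_Suc_shift) (simp add: c_def binomial_eq_0)
  also have "\<dots> + (\<Sum>j\<le>n. c (Suc j) * qbinomial p n j * y ^ Suc j)
           = 1 + (\<Sum>j\<le>n. c (Suc j) * qbinomial p (Suc n) (Suc j) * y ^ Suc j)"
    by (simp add: sum.distrib[symmetric] power_mult_distrib algebra_simps)
  also have "\<dots> = (\<Sum>j\<le>Suc n. c j * qbinomial p (Suc n) j * y ^ j)"
    by (simp add: c_def binomial_eq_0 sum.atMost_Suc_shift del: sum.atMost_Suc)
  finally show ?case by (simp add: c_def)
qed (simp add: binomial_eq_0)

text \<open>Folding about the middle: this later pairs the exponents -n and n + 1 of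
  \<open>z\<close> in the triple product.\<close>

lemma sum_lessThan_double:
  fixes f :: "nat \<Rightarrow> complex"
  shows "(\<Sum>j<N + N. f j) = (\<Sum>n<N. f (N - Suc n) + f (N + n))"
proof -
  have "(\<Sum>j<N + M. f j) = (\<Sum>j<N. f j) + (\<Sum>j<M. f (N + j))" for M
    by (induction M) simp_all
  thus ?thesis by (simp add: sum.distrib sum.nat_diff_reindex)
qed

section \<open>The triple product, first finite and then in the limit\<close>

context
  fixes z p :: complex
  assumes z: "z \<noteq> 0" and p0: "p \<noteq> 0" and p1: "norm p < 1"
begin

text \<open>Each factor satisfies 1 - z/p^k = -(z/p^k)(1 - p^k/z) for k = 1, ..., N, and the powers
  of \<open>p\<close> collect to a triangular exponent.\<close>

lemma qpoch_reflect:
  "qpoch (z / p ^ N) p N * p ^ (Suc N choose 2) = (- z) ^ N * qpoch (p / z) p N"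
proof (induction N)
  case (Suc N)
  have "qpoch (z / p ^ Suc N) p (Suc N) * p ^ (Suc (Suc N) choose 2)
      = (1 - z / p ^ Suc N) * p ^ Suc N * (qpoch (z / p ^ N) p N * p ^ (Suc N choose 2))"
    unfolding qpoch_Suc_shift using p0
    by (simp add: Suc_choose_two[of "Suc N"] power_add mult_ac)
  also have "\<dots> = (1 - z / p ^ Suc N) * p ^ Suc N * ((- z) ^ N * qpoch (p / z) p N)"
    by (simp only: Suc.IH)
  also have "(1 - z / p ^ Suc N) * p ^ Suc N = - z * (1 - p / z * p ^ N)"
    using z p0 by (simp add: field_simps)
  finally show ?case by (simp add: qpoch_Suc mult_ac)
qed (simp add: numeral_2_eq_2)

text \<open>Reflection merges the two products, up to a monomial, into the single product
  \<open>qpoch (z / p ^ N) p (Suc N + N)\<close>. Rothe's theorem expands it into 2N + 2 terms,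
  which are folded about the middle.\<close>

lemma finite_triple_product:
  "qpoch z p (Suc N) * qpoch (p / z) p N =
     (\<Sum>n\<le>N. (-1) ^ n * p ^ (Suc n choose 2) * (inverse z ^ n - z ^ Suc n)
        * qbinomial p (Suc N + N) (N - n))"
proof -
  \<comment> \<open>\<open>T\<close> is the monomial by which reflection turns
    \<open>qpoch (z / p ^ N) p N\<close> into \<open>qpoch (p / z) p N\<close>.\<close>
  define T where "T = p ^ (Suc N choose 2) * inverse (- z) ^ N"
  define f where "f j = (-1) ^ j * p ^ (j choose 2) * qbinomial p (Suc N + N) j * (z / p ^ N) ^ j" for j
  have zz: "inverse (- z) ^ N * (- z) ^ N = 1"
    unfolding power_mult_distrib[symmetric] using z by simp
  have sym: "qbinomial p (Suc N + N) (Suc N + n) = qbinomial p (Suc N + N) (N - n)" if "n \<le> N" for n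
    using qbinomial_eq[OF p1, of "Suc N + n" "N - n"] qbinomial_eq[OF p1, of "N - n" "Suc N + n"] that
    by (simp add: mult_ac add_ac)
  have zp: "(z / p ^ N) ^ m = z ^ m / p ^ (N * m)" for m
    by (simp add: power_divide power_mult)
  have upper: "T * f (Suc N + n) = - ((-1) ^ n * p ^ (Suc n choose 2) * z ^ Suc n * qbinomial p (Suc N + N) (N - n))"
    if "n \<le> N" for n
  proof -
    \<comment> \<open>After division by \<open>p ^ (N * (Suc N + n))\<close> the exponent of
      \<open>p\<close> is free of \<open>N\<close>, which makes termwise limits possible
      later.\<close>
    have e: "(Suc N choose 2) + (Suc N + n choose 2) = (Suc n choose 2) + N * (Suc N + n)"
      by (simp add: add_choose_two Suc_choose_two algebra_simps)
         (induction N; simp add: Suc_choose_two)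
    have "T * f (Suc N + n) = (inverse (- z) ^ N * (- z) ^ N) * (- ((-1) ^ n)) * z ^ Suc n
        * (p ^ ((Suc N choose 2) + (Suc N + n choose 2)) / p ^ (N * (Suc N + n))) * qbinomial p (Suc N + N) (Suc N + n)"
      unfolding T_def f_def zp by (simp add: power_add power_minus[of z] mult_ac)
    also have "\<dots> = - ((-1) ^ n * p ^ (Suc n choose 2) * z ^ Suc n * qbinomial p (Suc N + N) (N - n))"
      unfolding e zz sym[OF that] using p0 by (simp add: power_add)
    finally show ?thesis .
  qed
  have lower: "T * f (N - n) = (-1) ^ n * p ^ (Suc n choose 2) * inverse z ^ n * qbinomial p (Suc N + N) (N - n)"
    if "n \<le> N" for n
  proof -
    define d where "d = N - n"
    have d: "N = d + n" using that by (simp add: d_def)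
    have e: "(Suc N choose 2) + (d choose 2) = (Suc n choose 2) + N * d"
      unfolding d by (simp add: add_choose_two Suc_choose_two algebra_simps)
         (induction d; simp add: Suc_choose_two)
    have "T * f (N - n) = (inverse (- z) ^ d * (- z) ^ d) * (inverse (- z)) ^ n
        * (p ^ ((Suc N choose 2) + (d choose 2)) / p ^ (N * d)) * qbinomial p (Suc N + N) (N - n)"
      unfolding T_def f_def zp d_def[symmetric] arg_cong[OF d, of "\<lambda>m. inverse (- z) ^ m"] power_add
      by (simp add: power_minus[of z] mult_ac)
    also have "inverse (- z) ^ d * (- z) ^ d = 1"
      unfolding power_mult_distrib[symmetric] using z by simp
    finally show ?thesis
      unfolding e using p0 by (simp add: power_add power_minus[of "inverse z"] mult_ac)
  qed
  have "qpoch z p (Suc N) * qpoch (p / z) p N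
      = inverse (- z) ^ N * qpoch z p (Suc N) * ((- z) ^ N * qpoch (p / z) p N)"
    using zz by (simp add: mult_ac)
  also have "\<dots> = T * (qpoch (z / p ^ N) p N * qpoch z p (Suc N))"
    unfolding qpoch_reflect[symmetric] T_def by (simp add: mult_ac)
  also have "qpoch (z / p ^ N) p N * qpoch z p (Suc N) = qpoch (z / p ^ N) p (Suc N + N)"
    using qpoch_add[of "z / p ^ N" p N "Suc N"] p0 by (simp add: add_ac)
  also have "\<dots> = (\<Sum>j<Suc N + Suc N. f j)"
    unfolding rothe_qbinomial_theorem f_def by (simp add: lessThan_Suc_atMost)
  also have "\<dots> = (\<Sum>n<Suc N. f (N - n) + f (Suc N + n))"
    by (subst sum_lessThan_double) simp
  also have "T * \<dots> = (\<Sum>n<Suc N. T * f (N - n) + T * f (Suc N + n))"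
    by (simp add: sum_distrib_left ring_distribs)
  also have "\<dots> = (\<Sum>n<Suc N. (-1) ^ n * p ^ (Suc n choose 2) * (inverse z ^ n - z ^ Suc n)
        * qbinomial p (Suc N + N) (N - n))"
    by (intro sum.cong refl, unfold lessThan_iff less_Suc_eq_le, simp only: upper lower)
       (simp add: left_diff_distrib right_diff_distrib)
  finally show ?thesis by (simp add: lessThan_Suc_atMost)
qed

text \<open>Each term is |p|^(n+1) r times the previous one, and this ratio tends to 0 however large
  \<open>r\<close> is. The majorant below uses both \<open>norm z\<close> and
  \<open>inverse (norm z)\<close> as \<open>r\<close>.\<close>

lemma summable_triangular_power: "summable (\<lambda>n. norm p ^ (Suc n choose 2) * r ^ n)" if r: "r \<ge> 0" for r :: real
proof -
  have "(\<lambda>n. norm p ^ Suc n * r) \<longlonglongrightarrow> 0 * r"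
    using p1 by (intro tendsto_intros LIMSEQ_Suc LIMSEQ_realpow_zero) auto
  hence "eventually (\<lambda>n. norm p ^ Suc n * r < 1/2) sequentially"
    by (intro order_tendstoD) auto
  then obtain n0 where n0: "\<And>n. n \<ge> n0 \<Longrightarrow> norm p ^ Suc n * r < 1/2"
    by (auto simp: eventually_sequentially)
  show ?thesis
  proof (rule summable_ratio_test[of "1/2" n0])
    fix n assume "n \<ge> n0"
    have "norm p ^ (Suc (Suc n) choose 2) * r ^ Suc n
        = (norm p ^ Suc n * r) * (norm p ^ (Suc n choose 2) * r ^ n)"
      by (simp add: Suc_choose_two[of "Suc n"] power_add mult_ac)
    also have "\<dots> \<le> 1/2 * (norm p ^ (Suc n choose 2) * r ^ n)"
      using n0[OF \<open>n \<ge> n0\<close>] r by (intro mult_right_mono) auto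
    finally show "norm (norm p ^ (Suc (Suc n) choose 2) * r ^ Suc n)
        \<le> 1/2 * norm (norm p ^ (Suc n choose 2) * r ^ n)"
      using r by (simp add: abs_mult)
  qed simp
qed

text \<open>The terms of index \<open>-n\<close> and \<open>n+1\<close> of the bilateral series are paired.\<close>

theorem jacobi_triple_product:
  "(\<lambda>n. (-1) ^ n * p ^ (Suc n choose 2) * (inverse z ^ n - z ^ Suc n)) sums
     (qpoch_inf z p * qpoch_inf (p / z) p * qpoch_inf p p)"
proof -
  define c where "c n = (-1) ^ n * p ^ (Suc n choose 2) * (inverse z ^ n - z ^ Suc n)" for n
  \<comment> \<open>The finite identity is padded with zeros, so that the limit in \<open>N\<close>
    concerns series over one fixed index set.\<close>
  define a where "a n N = (if n \<le> N then c n * qbinomial p (Suc N + N) (N - n) else 0)" for n N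
  obtain A where A: "A > 0" "\<And>n. norm (qpoch p p n) \<le> A"
    using qpoch_bounded[OF p1] by blast
  obtain B where B: "B > 0" "\<And>n. norm (inverse (qpoch p p n)) \<le> B"
    using qpoch_inverse_bounded[OF p1 p1] by blast
  have qb: "qbinomial p (Suc N + N) (N - n)
      = qpoch p p (Suc N + N) * (inverse (qpoch p p (N - n)) * inverse (qpoch p p (Suc N + n)))"
    if "n \<le> N" for n N
    using qbinomial_eq[OF p1, of "N - n" "Suc N + n"] that by simp
  have nz: "qpoch p p n \<noteq> 0" "qpoch_inf p p \<noteq> 0" for n
    using qpoch_nonzero_of_small[OF p1 p1] by auto
  define M where "M n = norm p ^ (Suc n choose 2) * inverse (norm z) ^ n * (A * (B * B))
      + norm p ^ (Suc n choose 2) * norm z ^ n * (norm z * (A * (B * B)))" for n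
  \<comment> \<open>The Gaussian binomial tends to (p;p)_inf / (p;p)_inf^2. The remaining factor
    1/(p;p)_inf is multiplied away at the end.\<close>
  have lim: "(\<lambda>N. a n N) \<longlonglongrightarrow> c n * inverse (qpoch_inf p p)" for n
  proof (rule Lim_transform_eventually)
    have P: "qpoch p p \<longlonglongrightarrow> qpoch_inf p p" by (rule qpoch_tendsto[OF p1])
    have "(\<lambda>N. c n * (qpoch p p (Suc N + N) *
        (inverse (qpoch p p (N - n)) * inverse (qpoch p p (Suc N + n)))))
        \<longlonglongrightarrow> c n * (qpoch_inf p p * (inverse (qpoch_inf p p) * inverse (qpoch_inf p p)))"
      by (intro tendsto_intros nz filterlim_compose[OF P] filterlim_subseq filterlim_minus_const_nat_at_top)
         (auto simp: strict_mono_def)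
    thus "(\<lambda>N. c n * (qpoch p p (Suc N + N) *
        (inverse (qpoch p p (N - n)) * inverse (qpoch p p (Suc N + n)))))
        \<longlonglongrightarrow> c n * inverse (qpoch_inf p p)"
      using nz by (simp add: mult.assoc[symmetric])
    show "\<forall>\<^sub>F N in sequentially. c n * (qpoch p p (Suc N + N) *
        (inverse (qpoch p p (N - n)) * inverse (qpoch p p (Suc N + n)))) = a n N"
      using eventually_ge_at_top[of n] by eventually_elim (simp only: a_def qb if_True)
  qed
  have bound: "norm (a n N) \<le> M n" for n N
  proof (cases "n \<le> N")
    case True
    have "norm (inverse z ^ n - z ^ Suc n) \<le> inverse (norm z) ^ n + norm z ^ Suc n"
      by (rule order.trans[OF norm_triangle_ineq4]) (simp add: norm_power norm_inverse norm_mult)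
    hence "norm (c n) \<le> norm p ^ (Suc n choose 2) * (inverse (norm z) ^ n + norm z ^ Suc n)"
      unfolding c_def norm_mult norm_power by (simp add: mult_left_mono)
    moreover have "norm (qbinomial p (Suc N + N) (N - n)) \<le> A * (B * B)"
      unfolding qb[OF True] norm_mult using A B by (intro mult_mono) auto
    ultimately have "norm (a n N) \<le> norm p ^ (Suc n choose 2) * (inverse (norm z) ^ n + norm z ^ Suc n) * (A * (B * B))"
      unfolding a_def if_P[OF True] norm_mult by (intro mult_mono) auto
    thus ?thesis by (simp add: M_def algebra_simps)
  qed (use A B in \<open>auto simp: a_def M_def\<close>)
  have summable: "summable M"
    unfolding M_def by (intro summable_add summable_mult2 summable_triangular_power) auto
  note tannery = tendsto_suminf_dominated[OF lim bound summable]
  have "(\<Sum>n. a n N) = qpoch z p (Suc N) * qpoch (p / z) p N" for N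
  proof -
    have "(\<Sum>n. a n N) = (\<Sum>n\<le>N. a n N)"
      by (intro suminf_finite) (auto simp: a_def)
    also have "\<dots> = qpoch z p (Suc N) * qpoch (p / z) p N"
      unfolding finite_triple_product by (intro sum.cong) (auto simp: a_def c_def)
    finally show ?thesis .
  qed
  moreover have "(\<lambda>N. qpoch z p (Suc N) * qpoch (p / z) p N) \<longlonglongrightarrow> qpoch_inf z p * qpoch_inf (p / z) p"
    by (intro tendsto_intros qpoch_tendsto p1 LIMSEQ_Suc)
  ultimately have "(\<Sum>n. c n * inverse (qpoch_inf p p)) = qpoch_inf z p * qpoch_inf (p / z) p"
    using tannery(1) LIMSEQ_unique by auto
  with summable_sums[OF tannery(2)]
  have "(\<lambda>n. c n * inverse (qpoch_inf p p)) sums (qpoch_inf z p * qpoch_inf (p / z) p)"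
    by simp
  from sums_mult2[OF this, of "qpoch_inf p p"] show ?thesis
    using nz by (simp add: c_def[abs_def] mult.assoc)
qed

end

section \<open>Uniqueness of solutions of the Gordon system\<close>

text \<open>Iteration gives \<open>M 0 \<le> (\<Prod>k<n. 1 + e k) * M n\<close>. The products stay
  below \<open>exp (suminf e)\<close> while \<open>M n\<close> tends to 0.\<close>

lemma null_sequence_eq_0_of_growth:
  fixes M e :: "nat \<Rightarrow> real"
  assumes step: "\<And>n. M n \<le> (1 + e n) * M (Suc n)" and e: "\<And>n. e n \<ge> 0" "summable e"
    and nonneg: "\<And>n. M n \<ge> 0" and lim: "M \<longlonglongrightarrow> 0"
  shows "M 0 = 0"
proof -
  have "M 0 \<le> exp (suminf e) * M n" for n
  proof -
    have "M 0 \<le> (\<Prod>k<n. 1 + e k) * M n"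
    proof (induction n)
      case (Suc n)
      have "(\<Prod>k<n. 1 + e k) * M n \<le> (\<Prod>k<n. 1 + e k) * ((1 + e n) * M (Suc n))"
        using e by (intro mult_left_mono step prod_nonneg) auto
      with Suc show ?case by (simp add: mult.assoc)
    qed simp
    also have "\<dots> \<le> exp (\<Sum>k<n. e k) * M n"
      using e nonneg by (intro mult_right_mono prod_le_exp_sum)
    also have "\<dots> \<le> exp (suminf e) * M n"
      using e nonneg by (intro mult_right_mono) (auto intro: sum_le_suminf)
    finally show ?thesis .
  qed
  moreover have "(\<lambda>n. exp (suminf e) * M n) \<longlonglongrightarrow> exp (suminf e) * 0"
    by (intro tendsto_intros lim)
  ultimately have "M 0 \<le> exp (suminf e) * 0"
    using LIMSEQ_le_const[of "\<lambda>n. exp (suminf e) * M n" "exp (suminf e) * 0" "M 0"] by blast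
  with nonneg[of 0] show ?thesis by simp
qed

text \<open>The system expresses stage n through stage n + 1: first \<open>d1\<close>, then
  \<open>d2\<close>, then \<open>d3\<close>. The maximum of the three norms thus obeys a growth
  bound with summable perturbation.\<close>

lemma gordon_system_unique:
  fixes d1 d2 d3 :: "nat \<Rightarrow> complex"
  assumes p: "norm p < 1"
    and step: "\<And>n. d1 n = d3 (Suc n)" "\<And>n. d2 n - d1 n = p ^ Suc n * d2 (Suc n)"
      "\<And>n. d3 n - d2 n = p ^ (2 * Suc n) * d1 (Suc n)"
    and lim: "d1 \<longlonglongrightarrow> 0" "d2 \<longlonglongrightarrow> 0" "d3 \<longlonglongrightarrow> 0"
  shows "d1 0 = 0 \<and> d2 0 = 0 \<and> d3 0 = 0"
proof -
  define M where "M n = max (norm (d1 n)) (max (norm (d2 n)) (norm (d3 n)))" for n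
  have le: "norm (d1 n) \<le> M n" "norm (d2 n) \<le> M n" "norm (d3 n) \<le> M n" for n
    by (auto simp: M_def)
  have "M 0 = 0"
  \<comment> \<open>The 2 counts two corrections: one in the equation for \<open>d2\<close> and one
    in that for \<open>d3\<close>, where \<open>norm p ^ (2 * Suc n)\<close> is bounded by
    \<open>norm p ^ Suc n\<close>.\<close>
  proof (rule null_sequence_eq_0_of_growth[where e = "\<lambda>n. 2 * norm p ^ Suc n"])
    fix n
    define r where "r = norm p ^ Suc n"
    have r: "r \<ge> 0" by (simp add: r_def)
    have r2: "norm p ^ (2 * Suc n) \<le> r"
      unfolding r_def using p by (intro power_decreasing) auto
    have m: "0 \<le> M (Suc n)" using le(1)[of "Suc n"] norm_ge_zero order_trans by blast
    have b1: "norm (d1 n) \<le> M (Suc n)"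
      using le(3)[of "Suc n"] step(1)[of n] by simp
    have "norm (d2 n) \<le> norm (d1 n) + norm (p ^ Suc n * d2 (Suc n))"
      using norm_triangle_ineq[of "d1 n" "p ^ Suc n * d2 (Suc n)"] unfolding step(2)[symmetric] by simp
    also have "norm (p ^ Suc n * d2 (Suc n)) \<le> r * M (Suc n)"
      unfolding norm_mult norm_power r_def by (intro mult_left_mono le) auto
    finally have b2: "norm (d2 n) \<le> M (Suc n) + r * M (Suc n)" using b1 by simp
    have "norm (d3 n) \<le> norm (d2 n) + norm (p ^ (2 * Suc n) * d1 (Suc n))"
      using norm_triangle_ineq[of "d2 n" "p ^ (2 * Suc n) * d1 (Suc n)"] unfolding step(3)[symmetric] by simp
    also have "norm (p ^ (2 * Suc n) * d1 (Suc n)) \<le> r * M (Suc n)"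
      unfolding norm_mult norm_power using r r2 by (intro mult_mono le) auto
    finally have b3: "norm (d3 n) \<le> M (Suc n) + r * M (Suc n) + r * M (Suc n)" using b2 by simp
    have "0 \<le> r * M (Suc n)" using r m by simp
    with b1 b2 b3 have "M n \<le> M (Suc n) + 2 * (r * M (Suc n))"
      unfolding M_def[of n] by simp
    thus "M n \<le> (1 + 2 * norm p ^ Suc n) * M (Suc n)"
      by (simp add: r_def algebra_simps)
  next
    show "summable (\<lambda>n. 2 * norm p ^ Suc n)"
      using p by (intro summable_mult) (simp add: summable_geometric summable_mult)
    have "M \<longlonglongrightarrow> max (norm (0 :: complex)) (max (norm (0 :: complex)) (norm (0 :: complex)))"
      unfolding M_def by (intro tendsto_intros lim)
    thus "M \<longlonglongrightarrow> 0" by simp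
  qed (auto simp: M_def le_max_iff_disj)
  with le[of 0] show ?thesis by auto
qed

section \<open>The basic series and the theta series\<close>

text \<open>The shift \<open>K\<close> is a free parameter because the relations that change
  \<open>a\<close> also raise \<open>K\<close>.\<close>

definition slater_term :: "complex \<Rightarrow> nat \<Rightarrow> nat \<Rightarrow> nat \<Rightarrow> complex" where
  "slater_term q a K n = q ^ (n\<^sup>2 + a * n) / (qpoch q (q\<^sup>2) (n + K) * qpoch q q n)"

definition slater_sum :: "complex \<Rightarrow> nat \<Rightarrow> nat \<Rightarrow> complex" where
  "slater_sum q a K = (\<Sum>n. slater_term q a K n)"

text \<open>
  Up to a factor \<open>(q\<^sup>2;q\<^sup>2)\<^sub>\<infinity>\<close>, these are the terms of Andrews' series \<open>J\<^bsub>k,i\<^esub>(x;p)\<close> in base \<open>p = q\<^sup>2\<close>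
  at \<open>x = p^N\<close>, with \<open>k = i + j\<close>. Indexing by \<open>j\<close> instead of \<open>k\<close> avoids subtraction in the exponents.
\<close>

definition gordon_term :: "complex \<Rightarrow> nat \<Rightarrow> nat \<Rightarrow> nat \<Rightarrow> nat \<Rightarrow> complex" where
  "gordon_term q i j N n = (-1) ^ n * q ^ ((2*(i+j)+1) * n\<^sup>2 + (2*j+1) * n + 2*(i+j)*N*n)
     * (1 - q ^ (2*i*(N + 2*n + 1))) * qpoch (q\<^sup>2) (q\<^sup>2) (N + n) / qpoch (q\<^sup>2) (q\<^sup>2) n"

definition gordon_sum :: "complex \<Rightarrow> nat \<Rightarrow> nat \<Rightarrow> nat \<Rightarrow> complex" where
  "gordon_sum q i j N = (\<Sum>n. gordon_term q i j N n)"

lemma gordon_sum_0 [simp]: "gordon_sum q 0 j N = 0"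
  by (simp add: gordon_sum_def gordon_term_def)

lemma tendsto_power_mult_0:
  fixes q :: complex
  assumes "norm q < 1" "n > 0" "filterlim f at_top sequentially"
  shows "(\<lambda>N. q ^ (f N * n)) \<longlonglongrightarrow> 0"
proof -
  have "filterlim (\<lambda>N. f N * n) at_top sequentially"
    by (rule filterlim_at_top_mono[OF assms(3)]) (use assms(2) in \<open>auto intro!: always_eventually\<close>)
  thus ?thesis
    by (rule filterlim_compose[OF LIMSEQ_power_zero[OF assms(1)]])
qed

section \<open>The series \<open>U(a,K)\<close>: convergence, contiguous relations and limit\<close>

context
  fixes q :: complex
  assumes q0: "q \<noteq> 0" and q1: "norm q < 1"
begin

lemma norm_square_less_1: "norm (q\<^sup>2) < 1"
  using q1 by (simp add: norm_power power_less_one_iff)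

lemma qpoch_nonzero:
  "qpoch q q n \<noteq> 0" "qpoch q (q\<^sup>2) n \<noteq> 0" "qpoch (q\<^sup>2) (q\<^sup>2) n \<noteq> 0"
  "qpoch_inf q q \<noteq> 0" "qpoch_inf q (q\<^sup>2) \<noteq> 0" "qpoch_inf (q\<^sup>2) (q\<^sup>2) \<noteq> 0"
  using qpoch_nonzero_of_small[OF q1 q1] qpoch_nonzero_of_small[OF norm_square_less_1 q1]
    qpoch_nonzero_of_small[OF norm_square_less_1 norm_square_less_1] by auto

text \<open>Along even indices the odd and even exponents separate. This is what makes the limits of
  the two solutions of Gordon's system agree.\<close>

lemma qpoch_inf_mult_double: "qpoch_inf q q = qpoch_inf q (q\<^sup>2) * qpoch_inf (q\<^sup>2) (q\<^sup>2)"
proof (rule LIMSEQ_unique)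
  show "(\<lambda>n. qpoch q q (2 * n)) \<longlonglongrightarrow> qpoch_inf q q"
    by (rule filterlim_compose[OF qpoch_tendsto[OF q1] filterlim_subseq]) (auto simp: strict_mono_def)
  show "(\<lambda>n. qpoch q q (2 * n)) \<longlonglongrightarrow> qpoch_inf q (q\<^sup>2) * qpoch_inf (q\<^sup>2) (q\<^sup>2)"
    unfolding qpoch_mult_double by (intro tendsto_intros qpoch_tendsto norm_square_less_1)
qed

text \<open>Uniformity in \<open>a\<close> and \<open>K\<close> lets the bound dominate the limit in
  which both parameters grow, besides giving convergence.\<close>

lemma slater_term_bound: "\<exists>B>0. \<forall>a K n. norm (slater_term q a K n) \<le> B * norm q ^ n"
proof -
  obtain A where A: "A > 0" "\<And>n. norm (inverse (qpoch q (q\<^sup>2) n)) \<le> A"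
    using qpoch_inverse_bounded[OF norm_square_less_1 q1] by blast
  obtain B where B: "B > 0" "\<And>n. norm (inverse (qpoch q q n)) \<le> B"
    using qpoch_inverse_bounded[OF q1 q1] by blast
  have "norm (slater_term q a K n) \<le> (A * B) * norm q ^ n" for a K n
  proof -
    have "n \<le> n\<^sup>2 + a * n" by (cases n) (auto simp: power2_eq_square)
    hence "norm (q ^ (n\<^sup>2 + a * n)) \<le> norm q ^ n"
      unfolding norm_power using q1 by (intro power_decreasing) auto
    hence "norm (slater_term q a K n) \<le> norm q ^ n * (A * B)"
      unfolding slater_term_def divide_inverse inverse_mult_distrib norm_mult
      using A B by (intro mult_mono) auto
    thus ?thesis by (simp add: mult_ac)
  qed
  thus ?thesis using A B by (intro exI[of _ "A * B"]) auto
qed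

lemma slater_sums: "slater_term q a K sums slater_sum q a K"
proof -
  obtain B where "B > 0" "\<And>n. norm (slater_term q a K n) \<le> B * norm q ^ n"
    using slater_term_bound by blast
  hence "summable (slater_term q a K)"
    by (intro summable_comparison_test'[OF summable_mult[OF summable_geometric]]) (use q1 in auto)
  thus ?thesis unfolding slater_sum_def by (rule summable_sums)
qed

text \<open>The termwise difference has the factor \<open>1 - q ^ n\<close>: it kills the term n = 0
  and cancels the last factor of \<open>qpoch q q n\<close>; then n is shifted by one.\<close>

lemma slater_sum_shift_exponent:
  "slater_sum q a K - slater_sum q (Suc a) K = q ^ Suc a * slater_sum q (a + 2) (Suc K)"
proof -
  have t: "slater_term q a K n - slater_term q (Suc a) K n
      = q ^ (n\<^sup>2 + a * n) * (1 - q ^ n) / (qpoch q (q\<^sup>2) (n + K) * qpoch q q n)" for n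
    by (simp add: slater_term_def power_add diff_divide_distrib algebra_simps)
  have s: "slater_term q a K (Suc n) - slater_term q (Suc a) K (Suc n)
      = q ^ Suc a * slater_term q (a + 2) (Suc K) n" for n
  proof -
    have e: "(Suc n)\<^sup>2 + a * Suc n = Suc a + (n\<^sup>2 + (a + 2) * n)"
      by (simp add: power2_eq_square algebra_simps)
    have "1 - q ^ Suc n \<noteq> 0" using qpoch_nonzero(1)[of "Suc n"] by (simp add: qpoch_Suc)
    thus ?thesis
      unfolding t unfolding e slater_term_def by (simp add: qpoch_Suc[of q q] power_add)
  qed
  have "(\<lambda>n. slater_term q a K n - slater_term q (Suc a) K n) sums
      (slater_sum q a K - slater_sum q (Suc a) K)"
    by (intro sums_diff slater_sums)
  hence "(\<lambda>n. slater_term q a K (Suc n) - slater_term q (Suc a) K (Suc n)) sums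
      (slater_sum q a K - slater_sum q (Suc a) K)"
    by (subst sums_Suc_iff) (simp add: slater_term_def)
  moreover have "(\<lambda>n. q ^ Suc a * slater_term q (a + 2) (Suc K) n) sums
      (q ^ Suc a * slater_sum q (a + 2) (Suc K))"
    by (intro sums_mult slater_sums)
  ultimately show ?thesis unfolding s by (rule sums_unique2)
qed

text \<open>Raising \<open>K\<close> adds the factor
  \<open>1 - q ^ (2 * K + 1) * q ^ (2 * n)\<close> to the denominator. Expanding the same factor in
  the numerator gives the two series, where \<open>q ^ (2 * n)\<close> raises \<open>a\<close> by
  2.\<close>

lemma slater_sum_shift_index:
  "slater_sum q a K = slater_sum q a (Suc K) - q ^ (2 * K + 1) * slater_sum q (a + 2) (Suc K)"
proof -
  have "slater_term q a K n = slater_term q a (Suc K) n - q ^ (2 * K + 1) * slater_term q (a + 2) (Suc K) n" for n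
  proof -
    have eq: "q * (q\<^sup>2) ^ (n + K) = q ^ (2 * K + 1) * q ^ (2 * n)"
      by (simp add: power_add mult_ac flip: power_mult)
    have f: "qpoch q (q\<^sup>2) (n + Suc K) = qpoch q (q\<^sup>2) (n + K) * (1 - q ^ (2 * K + 1) * q ^ (2 * n))"
      by (simp only: add_Suc_right qpoch_Suc eq)
    have nz: "1 - q ^ (2 * K + 1) * q ^ (2 * n) \<noteq> 0"
      using qpoch_nonzero(2)[of "n + Suc K"] unfolding f by auto
    have "n\<^sup>2 + (a + 2) * n = (n\<^sup>2 + a * n) + 2 * n"
      by (simp add: algebra_simps)
    hence e: "q ^ (n\<^sup>2 + (a + 2) * n) = q ^ (n\<^sup>2 + a * n) * q ^ (2 * n)"
      by (simp only: power_add)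
    have "slater_term q a (Suc K) n - q ^ (2 * K + 1) * slater_term q (a + 2) (Suc K) n
      = q ^ (n\<^sup>2 + a * n) * (1 - q ^ (2 * K + 1) * q ^ (2 * n))
         / (qpoch q (q\<^sup>2) (n + K) * (1 - q ^ (2 * K + 1) * q ^ (2 * n)) * qpoch q q n)"
      unfolding slater_term_def f e by (simp add: diff_divide_distrib right_diff_distrib mult_ac)
    also have "\<dots> = slater_term q a K n"
      using nz by (simp add: slater_term_def)
    finally show ?thesis by simp
  qed
  hence "slater_term q a K = (\<lambda>n. slater_term q a (Suc K) n - q ^ (2 * K + 1) * slater_term q (a + 2) (Suc K) n)" ..
  moreover have "(\<lambda>n. slater_term q a (Suc K) n - q ^ (2 * K + 1) * slater_term q (a + 2) (Suc K) n) sums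
      (slater_sum q a (Suc K) - q ^ (2 * K + 1) * slater_sum q (a + 2) (Suc K))"
    by (intro sums_diff sums_mult slater_sums)
  ultimately show ?thesis
    using slater_sums[of a K] by (simp only: sums_unique2)
qed

text \<open>Only the term n = 0 survives, since q^(an) tends to 0 for n > 0.\<close>

lemma slater_sum_tendsto:
  assumes f: "filterlim f at_top sequentially" and g: "filterlim g at_top sequentially"
  shows "(\<lambda>N. slater_sum q (f N) (g N)) \<longlonglongrightarrow> inverse (qpoch_inf q (q\<^sup>2))"
proof -
  obtain B where B: "B > 0" "\<And>a K n. norm (slater_term q a K n) \<le> B * norm q ^ n"
    using slater_term_bound by blast
  define b where "b n = (if n = 0 then inverse (qpoch_inf q (q\<^sup>2)) else 0)" for n :: nat
  have "(\<lambda>N. slater_term q (f N) (g N) n) \<longlonglongrightarrow> b n" for n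
  proof -
    have "filterlim (\<lambda>N. n + g N) at_top sequentially"
      by (rule filterlim_at_top_mono[OF g]) auto
    from filterlim_compose[OF qpoch_tendsto[OF norm_square_less_1] this]
    have Q: "(\<lambda>N. qpoch q (q\<^sup>2) (n + g N)) \<longlonglongrightarrow> qpoch_inf q (q\<^sup>2)" .
    have p: "(\<lambda>N. q ^ (f N * n)) \<longlonglongrightarrow> (if n = 0 then 1 else 0)"
      using tendsto_power_mult_0[OF q1 _ f, of n] by auto
    have "(\<lambda>N. q ^ (n\<^sup>2) * q ^ (f N * n) / (qpoch q (q\<^sup>2) (n + g N) * qpoch q q n)) \<longlonglongrightarrow>
        q ^ (n\<^sup>2) * (if n = 0 then 1 else 0) / (qpoch_inf q (q\<^sup>2) * qpoch q q n)"
      by (intro tendsto_intros p Q) (simp add: qpoch_nonzero)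
    thus ?thesis by (simp add: slater_term_def power_add b_def inverse_eq_divide split: if_splits)
  qed
  hence "(\<lambda>N. slater_sum q (f N) (g N)) \<longlonglongrightarrow> (\<Sum>n. b n)"
    unfolding slater_sum_def
    by (rule tendsto_suminf_dominated[OF _ B(2)]) (auto intro!: summable_mult simp: q1 summable_geometric)
  also have "(\<Sum>n. b n) = (\<Sum>n\<in>{0}. b n)"
    by (intro suminf_finite) (auto simp: b_def)
  finally show ?thesis by (simp add: b_def)
qed

section \<open>The theta-type series: convergence, limit, functional equation and product
  form\<close>

lemma theta_term_bound:
  "\<exists>B>0. \<forall>N n e m. n \<le> e \<longrightarrow>
     norm ((-1) ^ n * q ^ e * (1 - q ^ m) * qpoch (q\<^sup>2) (q\<^sup>2) (N + n) / qpoch (q\<^sup>2) (q\<^sup>2) n) \<le> B * norm q ^ n"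
proof -
  obtain A where A: "A > 0" "\<And>n. norm (qpoch (q\<^sup>2) (q\<^sup>2) n) \<le> A"
    using qpoch_bounded[OF norm_square_less_1] by blast
  obtain B where B: "B > 0" "\<And>n. norm (inverse (qpoch (q\<^sup>2) (q\<^sup>2) n)) \<le> B"
    using qpoch_inverse_bounded[OF norm_square_less_1 norm_square_less_1] by blast
  \<comment> \<open>The exponents \<open>e\<close> and \<open>m\<close> stay free, so that one bound
    covers both \<open>gordon_term\<close> and the telescoping sequence of the functional
    equation.\<close>
  have "norm ((-1) ^ n * q ^ e * (1 - q ^ m) * qpoch (q\<^sup>2) (q\<^sup>2) (N + n) / qpoch (q\<^sup>2) (q\<^sup>2) n)
      \<le> (2 * A * B) * norm q ^ n" if "n \<le> e" for N n e m
  proof -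
    have 1: "norm (q ^ e) \<le> norm q ^ n"
      unfolding norm_power using q1 that by (intro power_decreasing) auto
    have "norm (1 - q ^ m) \<le> 1 + norm (q ^ m)"
      by (rule order.trans[OF norm_triangle_ineq4]) simp
    moreover have "norm (q ^ m) \<le> 1"
      unfolding norm_power using q1 by (intro power_le_one) auto
    ultimately have 2: "norm (1 - q ^ m) \<le> 2" by simp
    have "norm ((-1) ^ n * q ^ e * (1 - q ^ m) * qpoch (q\<^sup>2) (q\<^sup>2) (N + n) / qpoch (q\<^sup>2) (q\<^sup>2) n)
        \<le> 1 * norm q ^ n * 2 * A * B"
      unfolding divide_inverse norm_mult
      using A B 1 2 by (intro mult_mono) (auto simp: norm_power)
    thus ?thesis by (simp add: mult_ac)
  qed
  thus ?thesis using A B by (intro exI[of _ "2 * A * B"]) auto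
qed

lemma gordon_term_bound: "\<exists>B>0. \<forall>N n. norm (gordon_term q i j N n) \<le> B * norm q ^ n"
proof -
  obtain B where B: "B > 0" "\<And>N n e m. n \<le> e \<Longrightarrow>
      norm ((-1) ^ n * q ^ e * (1 - q ^ m) * qpoch (q\<^sup>2) (q\<^sup>2) (N + n) / qpoch (q\<^sup>2) (q\<^sup>2) n) \<le> B * norm q ^ n"
    using theta_term_bound by blast
  have "norm (gordon_term q i j N n) \<le> B * norm q ^ n" for N n
    unfolding gordon_term_def by (rule B(2)) simp
  with B(1) show ?thesis by blast
qed

lemma gordon_sums: "gordon_term q i j N sums gordon_sum q i j N"
proof -
  obtain B where "B > 0" "\<And>n. norm (gordon_term q i j N n) \<le> B * norm q ^ n"
    using gordon_term_bound[of i j] by blast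
  hence "summable (gordon_term q i j N)"
    by (intro summable_comparison_test'[OF summable_mult[OF summable_geometric]]) (use q1 in auto)
  thus ?thesis unfolding gordon_sum_def by (rule summable_sums)
qed

text \<open>Only the term n = 0 survives, namely (1 - q^(2i(N+1))) (q^2;q^2)_N. Its first factor
  tends to 1 because \<open>i > 0\<close>; for i = 0 the whole series is 0.\<close>

lemma gordon_sum_tendsto:
  assumes "i > 0"
  shows "gordon_sum q i j \<longlonglongrightarrow> qpoch_inf (q\<^sup>2) (q\<^sup>2)"
proof -
  obtain B where B: "B > 0" "\<And>N n. norm (gordon_term q i j N n) \<le> B * norm q ^ n"
    using gordon_term_bound[of i j] by blast
  define b where "b n = (if n = 0 then qpoch_inf (q\<^sup>2) (q\<^sup>2) else 0)" for n :: nat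
  have "(\<lambda>N. gordon_term q i j N n) \<longlonglongrightarrow> b n" for n
  proof -
    have id: "filterlim (\<lambda>N. N) at_top (sequentially :: nat filter)" by (rule filterlim_ident)
    have Q: "(\<lambda>N. qpoch (q\<^sup>2) (q\<^sup>2) (N + n)) \<longlonglongrightarrow> qpoch_inf (q\<^sup>2) (q\<^sup>2)"
      by (intro LIMSEQ_ignore_initial_segment qpoch_tendsto norm_square_less_1)
    have p: "(\<lambda>N. q ^ (N * (2*(i+j)*n))) \<longlonglongrightarrow> (if n = 0 then 1 else 0)"
      using tendsto_power_mult_0[OF q1 _ id, of "2*(i+j)*n"] assms by auto
    have r: "(\<lambda>N. q ^ ((N + (2*n+1)) * (2*i))) \<longlonglongrightarrow> 0"
      using assms by (intro tendsto_power_mult_0[OF q1] filterlim_at_top_mono[OF id]) auto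
    have "(\<lambda>N. (-1) ^ n * (q ^ ((2*(i+j)+1) * n\<^sup>2 + (2*j+1) * n) * q ^ (N * (2*(i+j)*n)))
         * (1 - q ^ ((N + (2*n+1)) * (2*i))) * qpoch (q\<^sup>2) (q\<^sup>2) (N + n) / qpoch (q\<^sup>2) (q\<^sup>2) n) \<longlonglongrightarrow>
       (-1) ^ n * (q ^ ((2*(i+j)+1) * n\<^sup>2 + (2*j+1) * n) * (if n = 0 then 1 else 0))
         * (1 - 0) * qpoch_inf (q\<^sup>2) (q\<^sup>2) / qpoch (q\<^sup>2) (q\<^sup>2) n"
      by (intro tendsto_intros p Q r) (simp add: qpoch_nonzero)
    moreover have "(-1) ^ n * (q ^ ((2*(i+j)+1) * n\<^sup>2 + (2*j+1) * n) * q ^ (N * (2*(i+j)*n)))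
         * (1 - q ^ ((N + (2*n+1)) * (2*i))) * qpoch (q\<^sup>2) (q\<^sup>2) (N + n) / qpoch (q\<^sup>2) (q\<^sup>2) n
         = gordon_term q i j N n" for N
      unfolding gordon_term_def power_add[symmetric] by (simp add: algebra_simps)
    ultimately show ?thesis by (simp add: b_def split: if_splits)
  qed
  hence "gordon_sum q i j \<longlonglongrightarrow> (\<Sum>n. b n)"
    unfolding gordon_sum_def
    by (rule tendsto_suminf_dominated[OF _ B(2)]) (auto intro!: summable_mult simp: q1 summable_geometric)
  also have "(\<Sum>n. b n) = (\<Sum>n\<in>{0}. b n)"
    by (intro suminf_finite) (auto simp: b_def)
  finally show ?thesis by (simp add: b_def)
qed

text \<open>Andrews' functional equation J(k,i+1;x) - J(k,i;x) = (xp)^i J(k,k-i;xp) with p = q^2, x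
  = p^N and k = i + j + 1. All three series share this k, and \<open>Suc j\<close> is k - i.\<close>

lemma gordon_sum_step:
  "gordon_sum q (Suc i) j N - gordon_sum q i (Suc j) N
     = q ^ (2 * i * Suc N) * gordon_sum q (Suc j) i (Suc N)"
proof -
  define k where "k = i + j + 1"
  \<comment> \<open>The difference of the two series agrees with the claimed one up to the telescoping sequence \<open>h\<close>.\<close>
  define h where "h n = (-1) ^ n * q ^ ((2*k+1) * n\<^sup>2 + (2*j+1) * n + 2*k*N*n) * (1 - q ^ (2*n))
     * qpoch (q\<^sup>2) (q\<^sup>2) (N + n) / qpoch (q\<^sup>2) (q\<^sup>2) n" for n
  have *: "gordon_term q (Suc i) j N n - gordon_term q i (Suc j) N n + (h (Suc n) - h n)
      = q ^ (2 * i * Suc N) * gordon_term q (Suc j) i (Suc N) n" for n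
  proof -
    \<comment> \<open>In these monomials the claim reads V X ((1 - s w y) - y (1 - s) - (1 - y)) - V
      X' (1 - w) = V (1 - w) (X y s - X').\<close>
    define X where "X = q ^ ((2*k+1) * n\<^sup>2 + (2*j+1) * n + 2*k*N*n)"
    define X' where "X' = q ^ ((2*k+1) * (Suc n)\<^sup>2 + (2*j+1) * Suc n + 2*k*N*Suc n)"
    define y where "y = q ^ (2 * n)"
    define w where "w = q ^ (2 * (N + n + 1))"
    define s where "s = q ^ (2 * i * (N + 2 * n + 1))"
    define V where "V = (-1) ^ n * qpoch (q\<^sup>2) (q\<^sup>2) (N + n) / qpoch (q\<^sup>2) (q\<^sup>2) n"
    have Q: "qpoch (q\<^sup>2) (q\<^sup>2) (Suc n) = qpoch (q\<^sup>2) (q\<^sup>2) n * (1 - q ^ (2 * Suc n))" for n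
      by (simp only: qpoch_Suc power_mult power_Suc[symmetric])
    have nz: "1 - q ^ (2 * Suc n) \<noteq> 0" using qpoch_nonzero(3)[of "Suc n"] unfolding Q by auto
    have 1: "gordon_term q (Suc i) j N n = V * X * (1 - s * w * y)"
      unfolding gordon_term_def V_def X_def s_def w_def y_def k_def power_add[symmetric]
      by (simp add: algebra_simps)
    have 2: "gordon_term q i (Suc j) N n = V * (X * y) * (1 - s)"
      unfolding gordon_term_def V_def X_def s_def y_def k_def power_add[symmetric]
      by (simp add: algebra_simps)
    have 3: "h n = V * X * (1 - y)"
      unfolding h_def V_def X_def y_def by (simp add: mult_ac)
    have 4: "h (Suc n) = - V * X' * (1 - w)"
    proof -
      have "h (Suc n) = (-1) ^ Suc n * X' * (1 - q ^ (2 * Suc n)) * qpoch (q\<^sup>2) (q\<^sup>2) (Suc (N + n))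
          / qpoch (q\<^sup>2) (q\<^sup>2) (Suc n)"
        by (simp add: h_def X'_def)
      thus ?thesis unfolding Q using nz by (simp add: V_def w_def)
    qed
    have dist: "q ^ a * q ^ b * (1 - q ^ c) * W = (q ^ (a + b) - q ^ (a + b + c)) * W" for a b c W
      by (simp add: power_add algebra_simps)
    have "q ^ (2 * i * Suc N) * gordon_term q (Suc j) i (Suc N) n
        = q ^ (2 * i * Suc N) * q ^ ((2*k+1) * n\<^sup>2 + (2*i+1) * n + 2*k*Suc N*n) *
          (1 - q ^ (2*Suc j*(Suc N + 2*n + 1))) * (V * (1 - w))"
      unfolding gordon_term_def V_def w_def k_def using Q[of "N + n"] by (simp add: add_ac mult_ac)
    also have "\<dots> = (q ^ (2 * i * Suc N + ((2*k+1) * n\<^sup>2 + (2*i+1) * n + 2*k*Suc N*n)) -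
        q ^ (2 * i * Suc N + ((2*k+1) * n\<^sup>2 + (2*i+1) * n + 2*k*Suc N*n) + 2*Suc j*(Suc N + 2*n + 1))) * (V * (1 - w))"
      by (rule dist)
    also have "2 * i * Suc N + ((2*k+1) * n\<^sup>2 + (2*i+1) * n + 2*k*Suc N*n)
        = ((2*k+1) * n\<^sup>2 + (2*j+1) * n + 2*k*N*n) + 2 * n + 2 * i * (N + 2 * n + 1)"
      by (simp add: k_def algebra_simps)
    also have "q ^ \<dots> = X * y * s"
      by (simp only: X_def y_def s_def power_add)
    also have "((2*k+1) * n\<^sup>2 + (2*j+1) * n + 2*k*N*n) + 2 * n + 2 * i * (N + 2 * n + 1) + 2*Suc j*(Suc N + 2*n + 1)
        = (2*k+1) * (Suc n)\<^sup>2 + (2*j+1) * Suc n + 2*k*N*Suc n"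
      by (simp add: k_def power2_eq_square algebra_simps)
    also have "q ^ \<dots> = X'" by (simp add: X'_def)
    finally show ?thesis unfolding 1 2 3 4 by (simp add: algebra_simps)
  qed
  \<comment> \<open>Since also \<open>h 0 = 0\<close>, the telescoping part contributes nothing to
    the sum.\<close>
  have "h \<longlonglongrightarrow> 0"
  proof -
    obtain B where B: "B > 0" "\<And>N n e m. n \<le> e \<Longrightarrow>
        norm ((-1) ^ n * q ^ e * (1 - q ^ m) * qpoch (q\<^sup>2) (q\<^sup>2) (N + n) / qpoch (q\<^sup>2) (q\<^sup>2) n) \<le> B * norm q ^ n"
      using theta_term_bound by blast
    have "norm (h n) \<le> B * norm q ^ n" for n
      unfolding h_def by (rule B(2)) simp
    moreover have "(\<lambda>n. B * norm q ^ n) \<longlonglongrightarrow> B * 0"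
      using q1 by (intro tendsto_intros LIMSEQ_realpow_zero) auto
    ultimately show ?thesis
      by (intro Lim_null_comparison[of h "\<lambda>n. B * norm q ^ n"]) auto
  qed
  hence "(\<lambda>n. h (Suc n) - h n) sums (0 - h 0)" by (rule telescope_sums)
  moreover have "(\<lambda>n. gordon_term q (Suc i) j N n - gordon_term q i (Suc j) N n) sums
      (gordon_sum q (Suc i) j N - gordon_sum q i (Suc j) N)"
    by (intro sums_diff gordon_sums)
  ultimately have "(\<lambda>n. q ^ (2 * i * Suc N) * gordon_term q (Suc j) i (Suc N) n) sums
      (gordon_sum q (Suc i) j N - gordon_sum q i (Suc j) N + (0 - h 0))"
    unfolding *[symmetric] by (rule sums_add[rotated])
  moreover have "h 0 = 0" by (simp add: h_def)
  moreover have "(\<lambda>n. q ^ (2 * i * Suc N) * gordon_term q (Suc j) i (Suc N) n) sums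
      (q ^ (2 * i * Suc N) * gordon_sum q (Suc j) i (Suc N))"
    by (intro sums_mult gordon_sums)
  ultimately show ?thesis using sums_unique2 by fastforce
qed

text \<open>At N = 0 the shifted factorials cancel, leaving the paired triple product series with
  base q^(4i+4j+2) at z = q^(2i).\<close>

lemma gordon_sum_product:
  "gordon_sum q i j 0 = qpochs_inf [q ^ (2*i), q ^ (2*i + 4*j + 2), q ^ (4*i + 4*j + 2)] (q ^ (4*i + 4*j + 2))"
proof -
  define p z where "p = q ^ (4*i + 4*j + 2)" and "z = q ^ (2*i)"
  have p1: "norm p < 1"
    unfolding p_def norm_power using q1 by (intro power_less_one_iff[THEN iffD2]) auto
  have nz: "p \<noteq> 0" "z \<noteq> 0" using q0 by (auto simp: p_def z_def)
  have pz: "p / z = q ^ (2*i + 4*j + 2)"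
    using q0 by (simp add: p_def z_def divide_eq_eq flip: power_add)
  have "(-1) ^ n * p ^ (Suc n choose 2) * (inverse z ^ n - z ^ Suc n) = gordon_term q i j 0 n" for n
  proof -
    have tri: "2 * (Suc n choose 2) = n\<^sup>2 + n"
      by (induction n) (simp_all add: Suc_choose_two[of "Suc _"] power2_eq_square)
    \<comment> \<open>The part 2in of the exponent is split off as \<open>z ^ n\<close>, which
      clears the inverse powers of \<open>z\<close>.\<close>
    have "p ^ (Suc n choose 2) = q ^ ((2*(i+j)+1) * (2 * (Suc n choose 2)))"
      unfolding p_def power_mult[symmetric] by (simp add: algebra_simps)
    also have "(2*(i+j)+1) * (2 * (Suc n choose 2)) = ((2*(i+j)+1) * n\<^sup>2 + (2*j+1) * n) + 2*i*n"
      unfolding tri by (simp add: algebra_simps)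
    also have "q ^ \<dots> = q ^ ((2*(i+j)+1) * n\<^sup>2 + (2*j+1) * n) * z ^ n"
      by (simp add: z_def power_add flip: power_mult)
    finally have 1: "p ^ (Suc n choose 2) = q ^ ((2*(i+j)+1) * n\<^sup>2 + (2*j+1) * n) * z ^ n" .
    have 2: "z ^ n * (inverse z ^ n - z ^ Suc n) = 1 - q ^ (2*i*(0 + 2*n + 1))"
    proof -
      have "z ^ n * inverse z ^ n = 1"
        unfolding power_mult_distrib[symmetric] using nz by simp
      moreover have "z ^ n * z ^ Suc n = q ^ (2*i*(0 + 2*n + 1))"
        unfolding z_def power_mult[symmetric] power_add[symmetric] by (simp add: algebra_simps)
      ultimately show ?thesis by (simp add: right_diff_distrib)
    qed
    have "(-1) ^ n * p ^ (Suc n choose 2) * (inverse z ^ n - z ^ Suc n)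
        = (-1) ^ n * q ^ ((2*(i+j)+1) * n\<^sup>2 + (2*j+1) * n) * (z ^ n * (inverse z ^ n - z ^ Suc n))"
      unfolding 1 by (simp add: mult_ac)
    thus ?thesis
      unfolding 2 gordon_term_def using qpoch_nonzero(3)[of n] by simp
  qed
  with jacobi_triple_product[OF nz(2,1) p1]
  have "gordon_term q i j 0 sums (qpoch_inf z p * qpoch_inf (p / z) p * qpoch_inf p p)"
    by simp
  hence "gordon_sum q i j 0 = qpoch_inf z p * qpoch_inf (p / z) p * qpoch_inf p p"
    using gordon_sums sums_unique2 by blast
  thus ?thesis unfolding pz by (simp add: p_def z_def qpochs_inf_def)
qed

section \<open>The identities modulo 14\<close>

text \<open>The pairs (i,j) = (1,2), (2,1), (3,0) have i + j = 3, hence product base q^14. The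
  scaled series and the theta series solve the same system with the same limit, so their differences
  vanish at N = 0.\<close>

lemma slater_mod14:
  "slater_sum q 2 1 = qpochs_inf [q ^ 2, q ^ 12, q ^ 14] (q ^ 14) / qpoch_inf q q"
  "slater_sum q 1 1 = qpochs_inf [q ^ 4, q ^ 10, q ^ 14] (q ^ 14) / qpoch_inf q q"
  "slater_sum q 0 0 = qpochs_inf [q ^ 6, q ^ 8, q ^ 14] (q ^ 14) / qpoch_inf q q"
proof -
  \<comment> \<open>Scaling by (q;q)_inf turns the limit 1/(q;q^2)_inf into (q^2;q^2)_inf, the limit
    of the theta series.\<close>
  define Q where "Q = qpoch_inf q q"
  define d1 d2 d3 where
    "d1 N = Q * slater_sum q (2 * N + 2) (Suc N) - gordon_sum q 1 2 N" and
    "d2 N = Q * slater_sum q (2 * N + 1) (Suc N) - gordon_sum q 2 1 N" and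
    "d3 N = Q * slater_sum q (2 * N) N - gordon_sum q 3 0 N" for N
  have lim: "(\<lambda>N. Q * slater_sum q (f N) (g N) - gordon_sum q i j N) \<longlonglongrightarrow> 0"
    if "i > 0" "filterlim f at_top sequentially" "filterlim g at_top sequentially" for f g i j
  proof -
    have "(\<lambda>N. Q * slater_sum q (f N) (g N) - gordon_sum q i j N) \<longlonglongrightarrow>
        Q * inverse (qpoch_inf q (q\<^sup>2)) - qpoch_inf (q\<^sup>2) (q\<^sup>2)"
      using that by (intro tendsto_intros slater_sum_tendsto gordon_sum_tendsto)
    moreover have "Q * inverse (qpoch_inf q (q\<^sup>2)) - qpoch_inf (q\<^sup>2) (q\<^sup>2) = 0"
      using qpoch_nonzero(5) by (simp add: Q_def qpoch_inf_mult_double)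
    ultimately show ?thesis by simp
  qed
  have ft: "filterlim (\<lambda>N. 2 * N + c) at_top sequentially" for c :: nat
    by (rule filterlim_subseq) (auto simp: strict_mono_def)
  have zero: "d1 0 = 0 \<and> d2 0 = 0 \<and> d3 0 = 0"
  proof (rule gordon_system_unique[OF norm_square_less_1])
    fix n
    show "d1 n = d3 (Suc n)"
      \<comment> \<open>For i = 0 the subtracted theta series is 0, while the two
        \<open>slater_sum\<close> expressions coincide outright.\<close>
      using gordon_sum_step[of 0 2 n] by (simp add: d1_def d3_def numeral_3_eq_3 numeral_2_eq_2)
    show "d2 n - d1 n = (q\<^sup>2) ^ Suc n * d2 (Suc n)"
    proof -
      have pow: "(q\<^sup>2) ^ Suc n = q ^ Suc (2 * n + 1)"
        unfolding power_mult[symmetric] by simp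
      have "slater_sum q (2 * n + 1) (Suc n) - slater_sum q (2 * n + 2) (Suc n)
          = (q\<^sup>2) ^ Suc n * slater_sum q (2 * Suc n + 1) (Suc (Suc n))"
        using slater_sum_shift_exponent[of "2*n+1" "Suc n"] unfolding pow by (simp del: power_Suc)
      moreover have "gordon_sum q 2 1 n - gordon_sum q 1 2 n = (q\<^sup>2) ^ Suc n * gordon_sum q 2 1 (Suc n)"
      proof -
        have "q ^ (2 * 1 * Suc n) = (q\<^sup>2) ^ Suc n"
          by (simp only: mult_1_right power_mult)
        thus ?thesis
          using gordon_sum_step[of 1 1 n] by (simp add: numeral_2_eq_2 del: power_Suc)
      qed
      ultimately show ?thesis unfolding d1_def d2_def by (simp add: algebra_simps)
    qed
    show "d3 n - d2 n = (q\<^sup>2) ^ (2 * Suc n) * d1 (Suc n)"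
    proof -
      have "slater_sum q (2 * n) n - slater_sum q (2 * n + 1) (Suc n)
          = (q\<^sup>2) ^ (2 * Suc n) * slater_sum q (2 * Suc n + 2) (Suc (Suc n))"
      proof -
        \<comment> \<open>Raising \<open>a\<close> at K = n and then \<open>K\<close> at a = 2n + 1
          leaves a difference to which the exponent shift applies again; the exponents 2n + 1 and 2n
          + 3 add up to 4(n + 1).\<close>
        have "slater_sum q (2 * n) n - slater_sum q (2 * n + 1) (Suc n)
            = q ^ (2*n+1) * (slater_sum q (2*n+2) (Suc n) - slater_sum q (2*n+3) (Suc n))"
          using slater_sum_shift_exponent[of "2*n" n] slater_sum_shift_index[of "2*n+1" n]
          by (simp add: algebra_simps numeral_3_eq_3)
        also have "\<dots> = q ^ (2*n+1) * (q ^ (2*n+3) * slater_sum q (2*n+4) (Suc (Suc n)))"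
          using slater_sum_shift_exponent[of "2*n+2" "Suc n"] by (simp add: eval_nat_numeral)
        also have "\<dots> = q ^ ((2*n+1) + (2*n+3)) * slater_sum q (2*n+4) (Suc (Suc n))"
          by (simp only: power_add mult.assoc)
        also have "(2*n+1) + (2*n+3) = 2 * (2 * Suc n)" by simp
        also have "q ^ \<dots> = (q\<^sup>2) ^ (2 * Suc n)" by (rule power_mult)
        finally show ?thesis by (simp add: eval_nat_numeral)
      qed
      moreover have "gordon_sum q 3 0 n - gordon_sum q 2 1 n = (q\<^sup>2) ^ (2 * Suc n) * gordon_sum q 1 2 (Suc n)"
      proof -
        have "q ^ (2 * 2 * Suc n) = (q\<^sup>2) ^ (2 * Suc n)"
          by (simp only: power_mult)
        thus ?thesis
          using gordon_sum_step[of 2 0 n] by (simp add: numeral_3_eq_3 del: power_Suc)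
      qed
      ultimately show ?thesis unfolding d1_def d2_def d3_def by (simp add: algebra_simps)
    qed
  next
    show "d1 \<longlonglongrightarrow> 0" "d2 \<longlonglongrightarrow> 0" "d3 \<longlonglongrightarrow> 0"
      using lim[OF _ ft[of 2] filterlim_Suc, of 1 2] lim[OF _ ft[of 1] filterlim_Suc, of 2 1]
        lim[OF _ ft[of 0] filterlim_ident, of 3 0]
      by (simp_all add: d1_def[abs_def] d2_def[abs_def] d3_def[abs_def])
  qed
  have prods: "gordon_sum q 1 2 0 = qpochs_inf [q ^ 2, q ^ 12, q ^ 14] (q ^ 14)"
    "gordon_sum q 2 1 0 = qpochs_inf [q ^ 4, q ^ 10, q ^ 14] (q ^ 14)"
    "gordon_sum q 3 0 0 = qpochs_inf [q ^ 6, q ^ 8, q ^ 14] (q ^ 14)"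
    by (simp_all add: gordon_sum_product)
  have "Q \<noteq> 0" using qpoch_nonzero(4) by (simp add: Q_def)
  with zero show
    "slater_sum q 2 1 = qpochs_inf [q ^ 2, q ^ 12, q ^ 14] (q ^ 14) / qpoch_inf q q"
    "slater_sum q 1 1 = qpochs_inf [q ^ 4, q ^ 10, q ^ 14] (q ^ 14) / qpoch_inf q q"
    "slater_sum q 0 0 = qpochs_inf [q ^ 6, q ^ 8, q ^ 14] (q ^ 14) / qpoch_inf q q"
    unfolding d1_def d2_def d3_def prods Q_def[symmetric] by (simp_all add: field_simps numeral_2_eq_2)
qed

end

section \<open>Recurrences in m, initial values and conclusion\<close>

lemma third_order_unique:
  fixes S X Y Z :: "nat \<Rightarrow> complex"
  assumes "\<And>m. S (m + 3) = \<alpha> m * S (m + 2) + b * S (m + 1) - b * S m"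
    and "\<And>m. X (m + 3) = \<alpha> m * X (m + 2) + b * X (m + 1) - b * X m"
    and "\<And>m. Y (m + 3) = \<alpha> m * Y (m + 2) + b * Y (m + 1) - b * Y m"
    and "\<And>m. Z (m + 3) = \<alpha> m * Z (m + 2) + b * Z (m + 1) - b * Z m"
    and "\<And>m. m < 3 \<Longrightarrow> S m = x * X m + y * Y m + z * Z m"
  shows "S m = x * X m + y * Y m + z * Z m"
proof (induction m rule: less_induct)
  case (less m)
  show ?case
  proof (cases "m < 3")
    case False
    then obtain k where k: "m = k + 3" by (metis add.commute le_Suc_ex not_less)
    show ?thesis
      unfolding k assms(1-4) using less[of k] less[of "k + 1"] less[of "k + 2"] k
      by (simp add: algebra_simps)
  qed (use assms(5) in auto)
qed

context
  fixes q :: complex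
  assumes q0: "q \<noteq> 0" and q1: "norm q < 1"
begin

text \<open>The exponent shifts at m and m + 2 bring in U(m+2,2) and U(m+4,2), and the index shift
  at m + 2 eliminates both. The factor \<open>inverse q\<close> lowers q^(m+1) to q^m to
  match.\<close>

lemma slater_sum_1_recurrence:
  "slater_sum q (m + 3) 1 = (1 + q ^ m) * slater_sum q (m + 2) 1
     + inverse q * slater_sum q (m + 1) 1 - inverse q * slater_sum q m 1"
proof -
  note shift = slater_sum_shift_exponent[OF q0 q1]
  have 1: "slater_sum q m 1 - slater_sum q (m + 1) 1 = q ^ Suc m * slater_sum q (m + 2) 2"
    using shift[of m 1] by (simp add: numeral_2_eq_2)
  have 2: "slater_sum q (m + 2) 1 - slater_sum q (m + 3) 1 = q ^ m * (q ^ 3 * slater_sum q (m + 4) 2)"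
    using shift[of "m + 2" 1] by (simp add: eval_nat_numeral mult_ac)
  have 3: "slater_sum q (m + 2) 1 = slater_sum q (m + 2) 2 - q ^ 3 * slater_sum q (m + 4) 2"
    using slater_sum_shift_index[OF q0 q1, of "m + 2" 1] by (simp add: eval_nat_numeral)
  have "inverse q * (slater_sum q m 1 - slater_sum q (m + 1) 1) = q ^ m * slater_sum q (m + 2) 2"
    unfolding 1 using q0 by simp
  also have "\<dots> = q ^ m * slater_sum q (m + 2) 1 + (slater_sum q (m + 2) 1 - slater_sum q (m + 3) 1)"
    unfolding 2 unfolding 3 by (simp add: algebra_simps)
  finally show ?thesis by (simp add: algebra_simps)
qed

text \<open>The same elimination with \<open>K\<close> lower by one; here the factor
  \<open>q\<close> raises q^(m+1) to q^(m+2).\<close>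

lemma slater_sum_0_recurrence:
  "slater_sum q (m + 3) 0 = (1 + q ^ (m + 2)) * slater_sum q (m + 2) 0
     + q * slater_sum q (m + 1) 0 - q * slater_sum q m 0"
proof -
  note shift = slater_sum_shift_exponent[OF q0 q1]
  have 1: "slater_sum q m 0 - slater_sum q (m + 1) 0 = q ^ Suc m * slater_sum q (m + 2) 1"
    using shift[of m 0] by simp
  have 2: "slater_sum q (m + 2) 0 - slater_sum q (m + 3) 0 = q ^ (m + 2) * (q * slater_sum q (m + 4) 1)"
    using shift[of "m + 2" 0] by (simp add: eval_nat_numeral mult_ac)
  have 3: "slater_sum q (m + 2) 0 = slater_sum q (m + 2) 1 - q * slater_sum q (m + 4) 1"
    using slater_sum_shift_index[OF q0 q1, of "m + 2" 0] by (simp add: eval_nat_numeral)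
  have "q * (slater_sum q m 0 - slater_sum q (m + 1) 0) = q ^ (m + 2) * slater_sum q (m + 2) 1"
    unfolding 1 by simp
  also have "\<dots> = q ^ (m + 2) * slater_sum q (m + 2) 0 + (slater_sum q (m + 2) 0 - slater_sum q (m + 3) 0)"
    unfolding 2 unfolding 3 by (simp add: algebra_simps)
  finally show ?thesis by (simp add: algebra_simps)
qed

text \<open>Links the two families, so that the initial values of each can be read off from the
  other.\<close>

lemma slater_sum_0_eq: "slater_sum q m 0 = slater_sum q m 1 - q * slater_sum q (m + 2) 1"
  using slater_sum_shift_index[OF q0 q1, of m 0] by simp

end

theorem theorem3p2:
  fixes q :: complex
  assumes q: "0 < norm q" "norm q < 1"
  shows
    "(\<forall>lam \<mu> \<nu> :: nat \<Rightarrow> complex.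
        (\<forall>x \<in> {lam, \<mu>, \<nu>}. \<forall>m\<ge>3.
           x m = (1 + q ^ (m - 3)) * x (m - 1) + inverse q * x (m - 2) - inverse q * x (m - 3)) \<and>
        lam 0 = q \<and> lam 1 = 0 \<and> lam 2 = 1 \<and>
        \<mu> 0 = 0 \<and> \<mu> 1 = 1 \<and> \<mu> 2 = 0 \<and>
        \<nu> 0 = 1 \<and> \<nu> 1 = 0 \<and> \<nu> 2 = 0 \<longrightarrow>
        (\<forall>m. (\<lambda>n. q ^ (n\<^sup>2 + m * n) / (qpoch q (q\<^sup>2) (n + 1) * qpoch q q n)) sums
           (qpochs_inf [q ^ 2, q ^ 12, q ^ 14] (q ^ 14) / qpoch_inf q q * lam m
          + qpochs_inf [q ^ 4, q ^ 10, q ^ 14] (q ^ 14) / qpoch_inf q q * \<mu> m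
          + qpochs_inf [q ^ 6, q ^ 8, q ^ 14] (q ^ 14) / qpoch_inf q q * \<nu> m)))
   \<and>
     (\<forall>E F G :: nat \<Rightarrow> complex.
        (\<forall>X \<in> {E, F, G}. \<forall>m\<ge>3.
           X m = (1 + q ^ (m - 1)) * X (m - 1) + q * X (m - 2) - q * X (m - 3)) \<and>
        E 0 = 0 \<and> E 1 = - q \<and> E 2 = - q - q\<^sup>2 \<and>
        F 0 = 0 \<and> F 1 = 0 \<and> F 2 = - q \<and>
        G 0 = 1 \<and> G 1 = 1 \<and> G 2 = 1 + q \<longrightarrow>
        (\<forall>m. (\<lambda>n. q ^ (n\<^sup>2 + m * n) / (qpoch q (q\<^sup>2) n * qpoch q q n)) sums
           (qpochs_inf [q ^ 2, q ^ 12, q ^ 14] (q ^ 14) / qpoch_inf q q * E m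
          + qpochs_inf [q ^ 4, q ^ 10, q ^ 14] (q ^ 14) / qpoch_inf q q * F m
          + qpochs_inf [q ^ 6, q ^ 8, q ^ 14] (q ^ 14) / qpoch_inf q q * G m)))"
proof -
  have q0: "q \<noteq> 0" and q1: "norm q < 1" using q by auto
  define P2 P4 P6 where
    "P2 = qpochs_inf [q ^ 2, q ^ 12, q ^ 14] (q ^ 14) / qpoch_inf q q" and
    "P4 = qpochs_inf [q ^ 4, q ^ 10, q ^ 14] (q ^ 14) / qpoch_inf q q" and
    "P6 = qpochs_inf [q ^ 6, q ^ 8, q ^ 14] (q ^ 14) / qpoch_inf q q"
  note mod14 = slater_mod14[OF q0 q1, folded P2_def P4_def P6_def]
  note sum_0_eq = slater_sum_0_eq[OF q0 q1]
  \<comment> \<open>U(1,1) and U(2,1) are known, so U(0,1) is the one missing initial value of the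
    first family; the link with U(0,0) gives it and explains \<open>lam 0 = q\<close>.\<close>
  have S0: "slater_sum q 0 1 = q * P2 + P6"
    using sum_0_eq[of 0] mod14 by (simp add: numeral_2_eq_2)
  \<comment> \<open>U(1,0) and U(2,0) require U(3,1) and U(4,1), which the recurrence supplies; the
    factor \<open>q\<close> clears \<open>inverse q\<close>.\<close>
  have S3: "q * slater_sum q 3 1 = q * P2 + P4 - P6"
  proof -
    have "slater_sum q 3 1 = 2 * P2 + inverse q * P4 - inverse q * (q * P2 + P6)"
      using slater_sum_1_recurrence[OF q0 q1, of 0] mod14 S0 by (simp add: numeral_2_eq_2)
    from arg_cong[OF this, of "\<lambda>x. q * x"] show ?thesis
      using q0 by (simp add: algebra_simps)
  qed
  have S4: "q * slater_sum q 4 1 = (1 + q + q\<^sup>2) * P2 + q * P4 - (1 + q) * P6"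
  proof -
    have "slater_sum q 4 1 = (1 + q) * slater_sum q 3 1 + inverse q * P2 - inverse q * P4"
      using slater_sum_1_recurrence[OF q0 q1, of 1] mod14 by (simp add: eval_nat_numeral)
    from arg_cong[OF this, of "\<lambda>x. q * x"]
    have "q * slater_sum q 4 1 = (1 + q) * (q * slater_sum q 3 1) + P2 - P4"
      using q0 by (simp add: algebra_simps)
    thus ?thesis unfolding S3 by (simp add: algebra_simps power2_eq_square)
  qed
  have T: "slater_sum q 1 0 = P6 - q * P2"
      "slater_sum q 2 0 = - (q + q\<^sup>2) * P2 - q * P4 + (1 + q) * P6"
  proof -
    have "slater_sum q 1 0 = P4 - q * slater_sum q 3 1"
      using sum_0_eq[of 1] mod14 by (simp add: numeral_3_eq_3)
    thus "slater_sum q 1 0 = P6 - q * P2" unfolding S3 by simp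
    have "slater_sum q 2 0 = P2 - q * slater_sum q 4 1"
      using sum_0_eq[of 2] mod14 by (simp add: eval_nat_numeral)
    thus "slater_sum q 2 0 = - (q + q\<^sup>2) * P2 - q * P4 + (1 + q) * P6"
      unfolding S4 by (simp add: algebra_simps)
  qed
  have less_3: "m < 3 \<longleftrightarrow> m = 0 \<or> m = 1 \<or> m = 2" for m :: nat by auto
  have part1: "slater_sum q m 1 = P2 * lam m + P4 * \<mu> m + P6 * \<nu> m"
    if rec: "\<forall>x \<in> {lam, \<mu>, \<nu>}. \<forall>m\<ge>3.
           x m = (1 + q ^ (m - 3)) * x (m - 1) + inverse q * x (m - 2) - inverse q * x (m - 3)"
      and init: "lam 0 = q" "lam 1 = 0" "lam 2 = 1" "\<mu> 0 = 0" "\<mu> 1 = 1" "\<mu> 2 = 0"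
        "\<nu> 0 = 1" "\<nu> 1 = 0" "\<nu> 2 = 0" for lam \<mu> \<nu> m
  proof (rule third_order_unique[where \<alpha> = "\<lambda>m. 1 + q ^ m" and b = "inverse q"])
    have "x (m + 3) = (1 + q ^ m) * x (m + 2) + inverse q * x (m + 1) - inverse q * x m"
      if "x \<in> {lam, \<mu>, \<nu>}" for x m
      using rec[rule_format, OF that, of "m + 3"] by simp
    thus "lam (m + 3) = (1 + q ^ m) * lam (m + 2) + inverse q * lam (m + 1) - inverse q * lam m"
      "\<mu> (m + 3) = (1 + q ^ m) * \<mu> (m + 2) + inverse q * \<mu> (m + 1) - inverse q * \<mu> m"
      "\<nu> (m + 3) = (1 + q ^ m) * \<nu> (m + 2) + inverse q * \<nu> (m + 1) - inverse q * \<nu> m" for m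
      by blast+
  qed (use init S0 mod14 in \<open>auto simp: less_3 slater_sum_1_recurrence[OF q0 q1] mult_ac simp del: One_nat_def\<close>)
  have part2: "slater_sum q m 0 = P2 * E m + P4 * F m + P6 * G m"
    if rec: "\<forall>X \<in> {E, F, G}. \<forall>m\<ge>3.
           X m = (1 + q ^ (m - 1)) * X (m - 1) + q * X (m - 2) - q * X (m - 3)"
      and init: "E 0 = 0" "E 1 = - q" "E 2 = - q - q\<^sup>2" "F 0 = 0" "F 1 = 0" "F 2 = - q"
        "G 0 = 1" "G 1 = 1" "G 2 = 1 + q" for E F G m
  proof (rule third_order_unique[where \<alpha> = "\<lambda>m. 1 + q ^ (m + 2)" and b = q])
    have "X (m + 3) = (1 + q ^ (m + 2)) * X (m + 2) + q * X (m + 1) - q * X m"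
      if "X \<in> {E, F, G}" for X m
      using rec[rule_format, OF that, of "m + 3"] by simp
    thus "E (m + 3) = (1 + q ^ (m + 2)) * E (m + 2) + q * E (m + 1) - q * E m"
      "F (m + 3) = (1 + q ^ (m + 2)) * F (m + 2) + q * F (m + 1) - q * F m"
      "G (m + 3) = (1 + q ^ (m + 2)) * G (m + 2) + q * G (m + 1) - q * G m" for m
      by blast+
    show "slater_sum q (m + 3) 0 = (1 + q ^ (m + 2)) * slater_sum q (m + 2) 0
       + q * slater_sum q (m + 1) 0 - q * slater_sum q m 0" for m
      by (rule slater_sum_0_recurrence[OF q0 q1])
    show "slater_sum q m 0 = P2 * E m + P4 * F m + P6 * G m" if "m < 3" for m
      using that T mod14(3) unfolding less_3 by (auto simp: init algebra_simps simp del: One_nat_def)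
  qed
  have sums: "(\<lambda>n. q ^ (n\<^sup>2 + m * n) / (qpoch q (q\<^sup>2) (n + K) * qpoch q q n)) sums slater_sum q m K" for m K
    using slater_sums[OF q0 q1, of m K] by (simp add: slater_term_def[abs_def])
  show ?thesis
    unfolding P2_def[symmetric] P4_def[symmetric] P6_def[symmetric]
  proof (intro conjI allI impI; elim conjE)
    fix lam \<mu> \<nu> :: "nat \<Rightarrow> complex" and m
    assume "\<forall>x \<in> {lam, \<mu>, \<nu>}. \<forall>m\<ge>3.
           x m = (1 + q ^ (m - 3)) * x (m - 1) + inverse q * x (m - 2) - inverse q * x (m - 3)"
      "lam 0 = q" "lam 1 = 0" "lam 2 = 1" "\<mu> 0 = 0" "\<mu> 1 = 1" "\<mu> 2 = 0"
      "\<nu> 0 = 1" "\<nu> 1 = 0" "\<nu> 2 = 0"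
    from part1[OF this, of m] show "(\<lambda>n. q ^ (n\<^sup>2 + m * n) / (qpoch q (q\<^sup>2) (n + 1) * qpoch q q n)) sums
        (P2 * lam m + P4 * \<mu> m + P6 * \<nu> m)"
      using sums[of m 1] by simp
  next
    fix E F G :: "nat \<Rightarrow> complex" and m
    assume "\<forall>X \<in> {E, F, G}. \<forall>m\<ge>3.
           X m = (1 + q ^ (m - 1)) * X (m - 1) + q * X (m - 2) - q * X (m - 3)"
      "E 0 = 0" "E 1 = - q" "E 2 = - q - q\<^sup>2" "F 0 = 0" "F 1 = 0" "F 2 = - q"
      "G 0 = 1" "G 1 = 1" "G 2 = 1 + q"
    from part2[OF this, of m] show "(\<lambda>n. q ^ (n\<^sup>2 + m * n) / (qpoch q (q\<^sup>2) n * qpoch q q n)) sums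
        (P2 * E m + P4 * F m + P6 * G m)"
      using sums[of m 0] by simp
  qed
qed

end
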